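(* There exists an absolute constant $c_0>0$ with the following property. Let $1\le p<\infty$, $n\in\mathbb N$, and let $(\mu_{ij})_{i,j=1}^n$ be a doubly stochastic $n\times n$ matrix, i.e. $\mu_{ij}\ge 0$ and $\sum_k\mu_{ik}=1=\sum_k\mu_{kj}$ for all $i,j$. Then $$\left(\sum_{j_1,\dots,j_n=1}^n\Big(\sup_{1\le r\le n}\frac1r\,\mathrm{card}\{i : j_i\le r\}\Big)^p\prod_{k=1}^n\mu_{kj_k}\right)^{1/p}\le c_0\,\frac{p}{1+\ln p}.$$ Moreover, the order of growth is optimal: there is an absolute constant $c>0$ such that for every $1\le p<\infty$, if $C$ is a constant which bounds the left-hand side for all $n$ and all doubly stochastic $n\times n$ matrices, then $C\ge c\,\frac{p}{1+\ln p}$.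
   Context: In the supremum, $r$ ranges over the integers $1,\dots,n$, and $\mathrm{card}\{i: j_i\le r\}$ counts indices $i\in\{1,\dots,n\}$. *)

theory Defs
  imports Complex_Main "HOL-Library.FuncSet"
begin

text \<open>An \<open>n \<times> n\<close> matrix is a function \<open>nat \<Rightarrow> nat \<Rightarrow> real\<close> of which only the entries with
  indices in \<open>{1..n}\<close> matter.\<close>

definition doubly_stochastic :: "nat \<Rightarrow> (nat \<Rightarrow> nat \<Rightarrow> real) \<Rightarrow> bool" where
  "doubly_stochastic n \<mu> \<longleftrightarrow>
     (\<forall>i\<in>{1..n}. \<forall>j\<in>{1..n}. 0 \<le> \<mu> i j) \<and>
     (\<forall>i\<in>{1..n}. (\<Sum>k=1..n. \<mu> i k) = 1) \<and>
     (\<forall>j\<in>{1..n}. (\<Sum>k=1..n. \<mu> k j) = 1)"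

text \<open>The real supremum below is over a finite set, nonempty only for \<open>n \<ge> 1\<close>.\<close>

definition sup_count :: "nat \<Rightarrow> (nat \<Rightarrow> nat) \<Rightarrow> real" where
  "sup_count n j = (SUP r\<in>{1..n}. 1 / real r * real (card {i\<in>{1..n}. j i \<le> r}))"

text \<open>A tuple \<open>(j\<^sub>1, \<dots>, j\<^sub>n)\<close> of indices is an extensional function on \<open>{1..n}\<close>, so that each
  tuple is counted exactly once.\<close>

definition sup_count_norm :: "real \<Rightarrow> nat \<Rightarrow> (nat \<Rightarrow> nat \<Rightarrow> real) \<Rightarrow> real" where
  "sup_count_norm p n \<mu> =
     (\<Sum>j\<in>{1..n} \<rightarrow>\<^sub>E {1..n}. sup_count n j powr p * (\<Prod>k=1..n. \<mu> k (j k))) powr (1 / p)"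

end

theory Submission
  imports Defs
begin

text \<open>Read the left-hand side as the \<open>L\<^sub>p\<close> norm of \<open>max\<^sub>r N\<^sub>r / r\<close>, where \<open>N\<^sub>r = card {i. j\<^sub>i \<le> r}\<close>
  for independent \<open>j\<^sub>i\<close> with laws given by the rows. Column sums give \<open>E N\<^sub>r = r\<close>, and so, as in
  Chernoff's bound, \<open>E q\<^bsup>N\<^sub>r\<^esup> \<le> exp ((q - 1) r)\<close> for \<open>q \<ge> 1\<close>. With \<open>q = e p\<close> and
  \<open>A = q / ln q = e p / (1 + ln p)\<close> one has \<open>(N\<^sub>r / r)\<^sup>p \<le> A\<^sup>p max (1, q\<^bsup>N\<^sub>r\<^esup> exp (- r q))\<close>;
  the expectations of the exponential terms are at most \<open>exp (- r)\<close>, which is summable over \<open>r\<close>.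

  For the lower bound take all entries equal to \<open>1 / n\<close> with \<open>n = \<lfloor>p / (1 + ln p)\<rfloor>\<close>. The single
  tuple \<open>(1, \<dots>, 1)\<close> contributes \<open>n\<^sup>p n\<^bsup>-n\<^esup>\<close>, and \<open>n ln n \<le> p\<close>.\<close>

section \<open>The supremum as a maximum, and the product weights as a probability
  distribution\<close>

lemma sup_count_attained:
  assumes "1 \<le> n"
  obtains r where "r \<in> {1..n}" "sup_count n j = real (card {i\<in>{1..n}. j i \<le> r}) / real r"
proof -
  let ?f = "\<lambda>r. 1 / real r * real (card {i\<in>{1..n}. j i \<le> r})"
  have "sup_count n j = Max (?f ` {1..n})"
    unfolding sup_count_def using assms by (intro cSup_eq_Max) auto
  also have "\<dots> \<in> ?f ` {1..n}"
    using assms by (intro Max_in) auto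
  finally show thesis
    using that by auto
qed

lemma sup_count_upper:
  assumes "r \<in> {1..n}"
  shows "real (card {i\<in>{1..n}. j i \<le> r}) / real r \<le> sup_count n j"
proof -
  have "1 / real r * real (card {i\<in>{1..n}. j i \<le> r}) \<le> sup_count n j"
    unfolding sup_count_def using assms
    by (intro cSUP_upper bdd_above_finite) auto
  then show ?thesis by simp
qed

text \<open>Distributivity turns the total mass of all tuples into the product of the row
  sums.\<close>

lemma sum_prod_weights_eq_1:
  assumes "doubly_stochastic n \<mu>"
  shows "(\<Sum>j\<in>{1..n} \<rightarrow>\<^sub>E {1..n}. \<Prod>k=1..n. \<mu> k (j k)) = 1"
proof -
  have "(\<Sum>j\<in>{1..n} \<rightarrow>\<^sub>E {1..n}. \<Prod>k=1..n. \<mu> k (j k)) = (\<Prod>k=1..n. \<Sum>l=1..n. \<mu> k l)"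
    by (subst prod_sum_PiE) auto
  also have "\<dots> = 1"
    using assms by (intro prod.neutral) (auto simp: doubly_stochastic_def)
  finally show ?thesis .
qed

lemma prod_weights_nonneg:
  assumes "doubly_stochastic n \<mu>" "j \<in> {1..n} \<rightarrow>\<^sub>E {1..n}"
  shows "0 \<le> (\<Prod>k=1..n. \<mu> k (j k))"
  using assms unfolding doubly_stochastic_def by (intro prod_nonneg) (auto dest: PiE_mem)

section \<open>Exponential moments and the upper bound\<close>

text \<open>The weights are products, so the sum over tuples factors by rows. Row \<open>k\<close>
  contributes \<open>1 + (q - 1) * s k\<close>, at most \<open>exp ((q - 1) * s k)\<close>, and the
  column sums make the \<open>s k\<close> add up to \<open>r\<close>.\<close>

lemma count_mgf_le:
  fixes q :: real
  assumes ds: "doubly_stochastic n \<mu>" and r: "r \<le> n" and q: "1 \<le> q"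
  shows "(\<Sum>j\<in>{1..n} \<rightarrow>\<^sub>E {1..n}. q ^ card {i\<in>{1..n}. j i \<le> r} * (\<Prod>k=1..n. \<mu> k (j k)))
           \<le> exp ((q - 1) * real r)"
proof -
  define s where "s k = (\<Sum>l=1..r. \<mu> k l)" for k
  have s_nonneg: "0 \<le> s k" if "k \<in> {1..n}" for k
    unfolding s_def using ds r that by (intro sum_nonneg) (auto simp: doubly_stochastic_def)
  have "q ^ card {i\<in>{1..n}. j i \<le> r} * (\<Prod>k=1..n. \<mu> k (j k))
          = (\<Prod>k=1..n. (if j k \<le> r then q else 1) * \<mu> k (j k))" for j :: "nat \<Rightarrow> nat"
  proof -
    have "q ^ card {i\<in>{1..n}. j i \<le> r} = (\<Prod>k=1..n. if j k \<le> r then q else 1)"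
      using prod.inter_filter[of "{1..n}" "\<lambda>_. q" "\<lambda>k. j k \<le> r"] by simp
    then show ?thesis by (simp add: prod.distrib)
  qed
  then have "(\<Sum>j\<in>{1..n} \<rightarrow>\<^sub>E {1..n}. q ^ card {i\<in>{1..n}. j i \<le> r} * (\<Prod>k=1..n. \<mu> k (j k)))
          = (\<Prod>k=1..n. \<Sum>l=1..n. (if l \<le> r then q else 1) * \<mu> k l)"
    by (subst prod_sum_PiE) auto
  also have "\<dots> = (\<Prod>k=1..n. 1 + (q - 1) * s k)"
  proof (intro prod.cong refl)
    fix k assume k: "k \<in> {1..n}"
    have "(\<Sum>l=1..n. (if l \<le> r then q else 1) * \<mu> k l)
            = (\<Sum>l=1..n. \<mu> k l + (q - 1) * (if l \<le> r then \<mu> k l else 0))"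
      by (intro sum.cong) (auto simp: algebra_simps)
    also have "\<dots> = (\<Sum>l=1..n. \<mu> k l) + (q - 1) * (\<Sum>l\<in>{l\<in>{1..n}. l \<le> r}. \<mu> k l)"
      by (simp only: sum.distrib sum_distrib_left[symmetric] sum.inter_filter[OF finite_atLeastAtMost])
    also have "{l\<in>{1..n}. l \<le> r} = {1..r}"
      using r by auto
    finally show "(\<Sum>l=1..n. (if l \<le> r then q else 1) * \<mu> k l) = 1 + (q - 1) * s k"
      using ds k by (simp add: doubly_stochastic_def s_def)
  qed
  also have "\<dots> \<le> (\<Prod>k=1..n. exp ((q - 1) * s k))"
    using s_nonneg q by (intro prod_mono) auto
  also have "\<dots> = exp ((q - 1) * (\<Sum>k=1..n. s k))"
    by (simp add: exp_sum sum_distrib_left)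
  also have "(\<Sum>k=1..n. s k) = (\<Sum>l=1..r. \<Sum>k=1..n. \<mu> k l)"
    unfolding s_def by (rule sum.swap)
  also have "\<dots> = real r"
    using ds r by (simp add: doubly_stochastic_def)
  finally show ?thesis .
qed

text \<open>Below the threshold \<open>A\<close> the constant 1 suffices. A ratio
  \<open>A * y\<close> above it is controlled by \<open>ln y \<le> y - 1\<close>, and
  \<open>A * ln q = q\<close> then turns \<open>r * q * y\<close> into
  \<open>N * ln q\<close>.\<close>

lemma ratio_powr_le_max:
  fixes A p q :: real
  assumes A: "0 < A" and q: "0 < q" "A * ln q = q" and p: "0 \<le> p" "p \<le> q" and r: "1 \<le> r"
  shows "(real N / real r) powr p \<le> A powr p * max 1 (q ^ N * exp (- (real r * q)))"
proof (cases "real N / real r \<le> A")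
  case True
  then have "(real N / real r) powr p \<le> A powr p * 1"
    using p by (simp add: powr_mono2)
  also have "\<dots> \<le> A powr p * max 1 (q ^ N * exp (- (real r * q)))"
    by (intro mult_left_mono) auto
  finally show ?thesis .
next
  case False
  define y where "y = real N / real r / A"
  have y: "1 < y" "real N / real r = A * y" "real N = real r * A * y"
    using False A r by (auto simp: y_def field_simps)
  have "y powr p = exp (p * ln y)"
    using y(1) by (simp add: powr_def)
  \<comment> \<open>The exponent \<open>p\<close> may be enlarged to \<open>r * q\<close> because
    \<open>p \<le> q\<close> and \<open>1 \<le> r\<close>.\<close>
  also have "\<dots> \<le> exp (real r * q * (y - 1))"
  proof -
    have "1 * q \<le> real r * q"
      using q r by (intro mult_right_mono) auto
    then have "p \<le> real r * q"
      using p by simp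
    moreover have "ln y \<le> y - 1"
      using y by (intro ln_le_minus_one) auto
    ultimately have "p * ln y \<le> real r * q * (y - 1)"
      using p y q by (intro mult_mono) auto
    then show ?thesis by simp
  qed
  also have "real r * q * (y - 1) = real N * ln q - real r * q"
  proof -
    have "real r * q * y = real r * (A * ln q) * y"
      using q by simp
    also have "\<dots> = real N * ln q"
      using y(3) by (simp add: algebra_simps)
    finally show ?thesis by (simp add: algebra_simps)
  qed
  also have "exp \<dots> = q ^ N * exp (- (real r * q))"
    using q(1) by (simp add: exp_diff exp_minus exp_of_nat_mult divide_inverse)
  finally have "A powr p * y powr p \<le> A powr p * max 1 (q ^ N * exp (- (real r * q)))"
    by (intro mult_left_mono) auto
  then show ?thesis
    using y A by (simp add: powr_mult)
qed

lemma sum_exp_minus_le_1: "(\<Sum>r=1..n. exp (- real r)) \<le> (1::real)"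
proof -
  have "(\<Sum>r=1..n. exp (- real r)) \<le> (\<Sum>r=1..n. (1 / 2 :: real) ^ r)"
  proof (rule sum_mono)
    fix r
    have "exp (- 1 :: real) \<le> 1 / 2"
      using exp_ge_add_one_self[of "1::real"] by (simp add: exp_minus field_simps)
    then have "exp (- 1 :: real) ^ r \<le> (1 / 2) ^ r"
      by (intro power_mono) auto
    then show "exp (- real r) \<le> (1 / 2) ^ r"
      by (simp add: exp_of_nat_mult[symmetric])
  qed
  also have "\<dots> = 1 - (1 / 2) ^ n"
    by (induction n) auto
  also have "\<dots> \<le> 1" by simp
  finally show ?thesis .
qed

lemma sup_count_norm_le:
  assumes p: "1 \<le> p" and n: "1 \<le> n" and ds: "doubly_stochastic n \<mu>"
  shows "sup_count_norm p n \<mu> \<le> 2 * exp 1 * (p / (1 + ln p))"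
proof -
  \<comment> \<open>The factor \<open>exp 1\<close> gives \<open>ln q = 1 + ln p\<close>, which is
    positive even at \<open>p = 1\<close>, and makes \<open>A\<close> equal to \<open>exp 1\<close>
    times the claimed rate.\<close>
  define q where "q = exp 1 * p"
  define A where "A = q / ln q"
  define w where "w j = (\<Prod>k=1..n. \<mu> k (j k))" for j
  define N where "N j r = card {i\<in>{1..n}. j i \<le> r}" for j :: "nat \<Rightarrow> nat" and r
  let ?P = "{1..n} \<rightarrow>\<^sub>E {1..n}"
  have e: "1 \<le> exp (1::real)" by simp
  have q: "1 \<le> q" "p \<le> q"
    unfolding q_def using p e mult_mono[of 1 "exp 1" 1 p] mult_right_mono[of 1 "exp 1" p] by auto
  have lnq: "ln q = 1 + ln p"
    unfolding q_def using p by (simp add: ln_mult)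
  have lnq_pos: "ln q > 0"
    using lnq p by (simp add: add_pos_nonneg)
  have A: "0 < A" "A * ln q = q"
    unfolding A_def using q lnq_pos by auto
  have w: "0 \<le> w j" if "j \<in> ?P" for j
    unfolding w_def using prod_weights_nonneg[OF ds that] .
  have pointwise: "sup_count n j powr p \<le> A powr p * (1 + (\<Sum>r=1..n. q ^ N j r * exp (- (real r * q))))" for j
  proof -
    obtain r where r: "r \<in> {1..n}" and sup: "sup_count n j = real (N j r) / real r"
      unfolding N_def using sup_count_attained[OF n] .
    have "sup_count n j powr p \<le> A powr p * max 1 (q ^ N j r * exp (- (real r * q)))"
      unfolding sup using r p q A by (intro ratio_powr_le_max) auto
    also have "\<dots> \<le> A powr p * (1 + q ^ N j r * exp (- (real r * q)))"
      using q by (intro mult_left_mono) auto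
    \<comment> \<open>The maximizing \<open>r\<close> depends on \<open>j\<close>. Adding the terms
      for all \<open>r\<close> removes this dependence, as in a union bound.\<close>
    also have "q ^ N j r * exp (- (real r * q)) \<le> (\<Sum>r=1..n. q ^ N j r * exp (- (real r * q)))"
      using r q by (intro member_le_sum) auto
    finally show ?thesis
      by (simp add: mult_left_mono)
  qed
  have "(\<Sum>j\<in>?P. sup_count n j powr p * w j)
          \<le> (\<Sum>j\<in>?P. A powr p * (1 + (\<Sum>r=1..n. q ^ N j r * exp (- (real r * q)))) * w j)"
    using pointwise w by (intro sum_mono mult_right_mono) auto
  also have "\<dots> = A powr p * ((\<Sum>j\<in>?P. w j) + (\<Sum>j\<in>?P. \<Sum>r=1..n. exp (- (real r * q)) * (q ^ N j r * w j)))"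
    by (simp add: sum_distrib_left sum_distrib_right sum.distrib algebra_simps)
  also have "(\<Sum>j\<in>?P. \<Sum>r=1..n. exp (- (real r * q)) * (q ^ N j r * w j))
          = (\<Sum>r=1..n. exp (- (real r * q)) * (\<Sum>j\<in>?P. q ^ N j r * w j))"
    by (subst sum.swap) (simp add: sum_distrib_left)
  also have "A powr p * ((\<Sum>j\<in>?P. w j) + \<dots>) \<le> A powr p * (1 + (\<Sum>r=1..n. exp (- real r)))"
  proof (intro mult_left_mono add_mono sum_mono)
    show "(\<Sum>j\<in>?P. w j) \<le> 1"
      unfolding w_def sum_prod_weights_eq_1[OF ds] by simp
    fix r assume "r \<in> {1..n}"
    then have "(\<Sum>j\<in>?P. q ^ N j r * w j) \<le> exp ((q - 1) * real r)"
      unfolding N_def w_def using count_mgf_le[OF ds _ q(1)] by simp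
    \<comment> \<open>The damping by \<open>exp (- (r * q))\<close> cancels the growth of the moment
      bound up to \<open>exp (- r)\<close>, whatever \<open>p\<close> is.\<close>
    then have "exp (- (real r * q)) * (\<Sum>j\<in>?P. q ^ N j r * w j)
            \<le> exp (- (real r * q)) * exp ((q - 1) * real r)"
      by (intro mult_left_mono) auto
    also have "\<dots> = exp (- real r)"
      by (simp add: exp_add[symmetric] algebra_simps)
    finally show "exp (- (real r * q)) * (\<Sum>j\<in>?P. q ^ N j r * w j) \<le> exp (- real r)" .
  qed auto
  also have "\<dots> \<le> A powr p * 2"
    using sum_exp_minus_le_1[of n] by (intro mult_left_mono) auto
  finally have "(\<Sum>j\<in>?P. sup_count n j powr p * w j) \<le> A powr p * 2" .
  then have "sup_count_norm p n \<mu> \<le> (A powr p * 2) powr (1 / p)"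
    unfolding sup_count_norm_def w_def[symmetric] using p w
    by (intro powr_mono2 sum_nonneg) auto
  also have "\<dots> = A * 2 powr (1 / p)"
    using A p by (simp add: powr_mult powr_powr)
  \<comment> \<open>Bounding the root of 2 by 2 keeps the constant independent of
    \<open>p\<close>.\<close>
  also have "2 powr (1 / p) \<le> 2 powr 1"
    using p by (intro powr_mono) auto
  finally have "sup_count_norm p n \<mu> \<le> A * 2"
    using A by (simp add: mult_left_mono)
  then show ?thesis
    using lnq by (simp add: A_def q_def mult_ac)
qed

section \<open>The uniform matrix and the lower bound\<close>

lemma doubly_stochastic_uniform:
  assumes "1 \<le> n"
  shows "doubly_stochastic n (\<lambda>_ _. 1 / real n)"
  using assms by (simp add: doubly_stochastic_def)

lemma sup_count_norm_uniform_ge: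
  assumes p: "1 \<le> p" and n: "1 \<le> n"
  shows "real n * exp (- (real n * ln (real n) / p)) \<le> sup_count_norm p n (\<lambda>_ _. 1 / real n)"
proof -
  let ?P = "{1..n} \<rightarrow>\<^sub>E {1..n}"
  define one where "one = (\<lambda>i\<in>{1..n}. 1::nat)"
  let ?g = "\<lambda>j. sup_count n j powr p * (\<Prod>k=1..n. 1 / real n)"
  have one: "one \<in> ?P"
    unfolding one_def using n by auto
  have "{i\<in>{1..n}. one i \<le> 1} = {1..n}"
    by (auto simp: one_def)
  then have "real n \<le> sup_count n one"
    using sup_count_upper[of 1 n one] n by simp
  \<comment> \<open>Already \<open>r = 1\<close> counts all \<open>n\<close> indices of the constant
    tuple. All other tuples contribute nonnegative terms and are dropped.\<close>
  then have "real n powr p * (\<Prod>k=1..n. 1 / real n) \<le> ?g one"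
    using p by (intro mult_right_mono powr_mono2) auto
  also have "?g one \<le> (\<Sum>j\<in>?P. ?g j)"
    using one by (intro member_le_sum finite_PiE) auto
  finally have "(real n powr p * (\<Prod>k=1..n. 1 / real n)) powr (1 / p)
      \<le> sup_count_norm p n (\<lambda>_ _. 1 / real n)"
    unfolding sup_count_norm_def using p by (intro powr_mono2) auto
  moreover have "(\<Prod>k=1..n. 1 / real n) = exp (- (real n * ln (real n)))"
    using n by (simp add: exp_minus exp_of_nat_mult power_one_over divide_inverse power_inverse)
  ultimately show ?thesis
    using p n by (simp add: powr_mult powr_powr exp_powr_real)
qed

text \<open>The size \<open>n\<close> is chosen so that the tuple's probability costs at most a
  factor \<open>exp 1\<close> after the \<open>p\<close>-th root. Rounding down costs at most a
  factor 2.\<close>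

lemma uniform_bound_ge:
  fixes p C :: real
  assumes p: "1 \<le> p"
    and C: "\<And>n. 1 \<le> n \<Longrightarrow> sup_count_norm p n (\<lambda>_ _. 1 / real n) \<le> C"
  shows "1 / (2 * exp 1) * (p / (1 + ln p)) \<le> C"
proof -
  define x where "x = p / (1 + ln p)"
  define n where "n = nat \<lfloor>x\<rfloor>"
  have lnp: "0 \<le> ln p" "1 + ln p \<le> p"
    using p ln_le_minus_one[of p] by auto
  have pos: "0 < 1 + ln p"
    using lnp by linarith
  \<comment> \<open>From \<open>1 + ln p \<le> p\<close> one gets \<open>1 \<le> x\<close>, so the
    floor is a legitimate matrix size.\<close>
  have x: "1 \<le> x" "x * (1 + ln p) = p"
    using lnp(2) pos by (auto simp: x_def le_divide_eq)
  have "x \<le> p"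
    using x lnp mult_left_mono[of 1 "1 + ln p" x] by simp
  have n: "1 \<le> n" "real n \<le> x" "x < real n + 1"
    using x(1) unfolding n_def by linarith+
  have "ln (real n) \<le> ln p"
    using n x \<open>x \<le> p\<close> by simp
  then have "real n * ln (real n) \<le> x * (1 + ln p)"
    using n x by (intro mult_mono) auto
  then have "real n * ln (real n) / p \<le> 1"
    using x p by simp
  then have "real n * exp (- 1) \<le> real n * exp (- (real n * ln (real n) / p))"
    by (intro mult_left_mono) auto
  also have "\<dots> \<le> C"
    using sup_count_norm_uniform_ge[OF p n(1)] C[OF n(1)] by simp
  finally have "real n * exp (- 1) \<le> C" .
  \<comment> \<open>Since \<open>1 \<le> n\<close>, \<open>x < n + 1 \<le> 2 * n\<close>.\<close>
  moreover have "x / 2 * exp (- 1) \<le> real n * exp (- 1)"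
    using n(1,3) by (intro mult_right_mono) (linarith, simp)
  ultimately have "x / 2 * exp (- 1) \<le> C" by linarith
  moreover have "1 / (2 * exp 1) * x = x / 2 * exp (- 1)"
    by (simp add: exp_minus field_simps)
  ultimately show ?thesis
    unfolding x_def by simp
qed

theorem theorem0p3:
  shows "(\<exists>c\<^sub>0::real. c\<^sub>0 > 0 \<and>
            (\<forall>(p::real) (n::nat) (\<mu> :: nat \<Rightarrow> nat \<Rightarrow> real).
               1 \<le> p \<longrightarrow> 1 \<le> n \<longrightarrow> doubly_stochastic n \<mu> \<longrightarrow>
               sup_count_norm p n \<mu> \<le> c\<^sub>0 * (p / (1 + ln p)))) \<and>
         (\<exists>c::real. c > 0 \<and>
            (\<forall>(p::real) (C::real).
               1 \<le> p \<longrightarrow>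
               (\<forall>(n::nat) (\<mu> :: nat \<Rightarrow> nat \<Rightarrow> real).
                  1 \<le> n \<longrightarrow> doubly_stochastic n \<mu> \<longrightarrow> sup_count_norm p n \<mu> \<le> C) \<longrightarrow>
               C \<ge> c * (p / (1 + ln p))))"
proof (intro conjI exI allI impI)
  show "2 * exp 1 > (0::real)" "1 / (2 * exp 1) > (0::real)"
    by simp_all
next
  fix p :: real and n :: nat and \<mu> :: "nat \<Rightarrow> nat \<Rightarrow> real"
  assume "1 \<le> p" "1 \<le> n" "doubly_stochastic n \<mu>"
  then show "sup_count_norm p n \<mu> \<le> 2 * exp 1 * (p / (1 + ln p))"
    by (rule sup_count_norm_le)
next
  fix p C :: real
  assume "1 \<le> p"
    and "\<forall>(n::nat) (\<mu> :: nat \<Rightarrow> nat \<Rightarrow> real).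
           1 \<le> n \<longrightarrow> doubly_stochastic n \<mu> \<longrightarrow> sup_count_norm p n \<mu> \<le> C"
  then show "1 / (2 * exp 1) * (p / (1 + ln p)) \<le> C"
    by (intro uniform_bound_ge) (simp_all add: doubly_stochastic_uniform)
qed

end
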